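(* Let $G$ be a graph containing no induced subgraph isomorphic to $C_4$, with $\delta(G)\leq 3$. Then $\chi_{FF}(G)\geq \delta(G)+1$.
   Context: All graphs are finite, simple and undirected. $C_4$ is the cycle on 4 vertices. $\delta(G)$ is the minimum degree of $G$. A Grundy $k$-coloring of $G$ is a proper coloring with colors $\{1,\dots,k\}$ such that for any $i<j$, every vertex colored $j$ has a neighbor colored $i$; $\chi_{FF}(G)$ (the First-Fit or Grundy chromatic number) is the largest $k$ for which a Grundy $k$-coloring exists. *)

theory Defs
  imports "Graph_Theory.Graph_Theory"
begin

text \<open>
  A finite simple undirected graph is a \<open>pair_graph\<close>: finite vertex set, and a set of arcs
  (ordered pairs of vertices) that is irreflexive and symmetric. An undirected edge \<open>uv\<close> is the
  pair of arcs \<open>(u,v)\<close>, \<open>(v,u)\<close>, so the degree of a vertex is its out-degree.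
\<close>

definition min_degree :: "('a, 'b) pre_digraph \<Rightarrow> nat" where
  "min_degree G = Min (out_degree G ` verts G)"

text \<open>A cycle only for \<open>n \<ge> 3\<close> (for \<open>n = 1\<close> it has a loop).\<close>

definition cycle_graph :: "nat \<Rightarrow> nat pair_pre_digraph" where
  "cycle_graph n =
     \<lparr> pverts = {..<n},
       parcs = {(i, j). i < n \<and> j < n \<and> (j = Suc i mod n \<or> i = Suc j mod n)} \<rparr>"

definition has_induced :: "('a, 'b) pre_digraph \<Rightarrow> ('c, 'd) pre_digraph \<Rightarrow> bool" where
  "has_induced G F \<longleftrightarrow> (\<exists>H. induced_subgraph H G \<and> digraph_iso H F)"

text \<open>
  All of the colors \<open>1, \<dots>, k\<close> are used; otherwise \<open>k\<close> could be increased at will without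
  changing the coloring, and no largest \<open>k\<close> would exist.
\<close>

definition grundy_coloring :: "('a, 'b) pre_digraph \<Rightarrow> nat \<Rightarrow> ('a \<Rightarrow> nat) \<Rightarrow> bool" where
  "grundy_coloring G k c \<longleftrightarrow>
     c ` verts G = {1..k} \<and>
     (\<forall>u v. u \<rightarrow>\<^bsub>G\<^esub> v \<longrightarrow> c u \<noteq> c v) \<and>
     (\<forall>i\<in>{1..k}. \<forall>j\<in>{1..k}. i < j \<longrightarrow>
        (\<forall>v\<in>verts G. c v = j \<longrightarrow> (\<exists>u\<in>verts G. v \<rightarrow>\<^bsub>G\<^esub> u \<and> c u = i)))"

definition grundy_number :: "('a, 'b) pre_digraph \<Rightarrow> nat" where
  "grundy_number G = Max {k. \<exists>c. grundy_coloring G k c}"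

text \<open>The maximum in the last definition is over a finite nonempty set.\<close>

lemma finite_grundy_colorings:
  assumes "finite (verts G)"
  shows "finite {k. \<exists>c. grundy_coloring G k c}"
proof (rule finite_subset)
  have "k \<le> card (verts G)" if "grundy_coloring G k c" for k c
    using card_image_le[OF assms, of c] that by (simp add: grundy_coloring_def)
  then show "{k. \<exists>c. grundy_coloring G k c} \<subseteq> {..card (verts G)}" by auto
qed simp

lemma (in pair_graph) grundy_coloring_exists: "\<exists>k c. grundy_coloring G k c"
proof -
  define P where "P c \<longleftrightarrow> (\<forall>v\<in>pverts G. c v \<ge> 1) \<and> (\<forall>u v. (u, v) \<in> parcs G \<longrightarrow> c u \<noteq> c v)"
    for c :: "'a \<Rightarrow> nat"
  obtain f :: "'a \<Rightarrow> nat" where f: "inj_on f (pverts G)"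
    using finite_imp_inj_to_nat_seg[OF pair_finite_verts] by blast
  have "P (\<lambda>v. Suc (f v))"
    unfolding P_def using f pair_no_loops by (fastforce dest: inj_onD wellformed')
  then obtain c where c: "P c" and least: "\<And>c'. P c' \<Longrightarrow> sum c (pverts G) \<le> sum c' (pverts G)"
    using ex_has_least_nat[of P _ "\<lambda>c. sum c (pverts G)"] by blast
  have nb: "\<exists>u\<in>pverts G. (v, u) \<in> parcs G \<and> c u = i"
    if v: "v \<in> pverts G" and i: "1 \<le> i" "i < c v" for v i
  proof (rule ccontr)
    assume no: "\<not> ?thesis"
    have sym: "(b, a) \<in> parcs G" if "(a, b) \<in> parcs G" for a b
      using that pair_sym_arcs by (auto simp: symmetric_def sym_def)
    have "P (c(v := i))"
      unfolding P_def
    proof (intro conjI ballI allI impI)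
      fix a b assume ab: "(a, b) \<in> parcs G"
      show "(c(v := i)) a \<noteq> (c(v := i)) b"
        using ab c no sym[OF ab] pair_no_loops[OF ab] wellformed'[OF ab]
        unfolding P_def by auto
    qed (use c i in \<open>auto simp: P_def\<close>)
    moreover have "sum (c(v := i)) (pverts G) < sum c (pverts G)"
      by (rule sum_strict_mono_ex1) (use v i pair_finite_verts in auto)
    ultimately show False using least by fastforce
  qed
  have "\<exists>k. c ` pverts G = {1..k}"
  proof (cases "pverts G = {}")
    case True
    then show ?thesis by (intro exI[of _ 0]) simp
  next
    case False
    define k where "k = Max (c ` pverts G)"
    have "k \<in> c ` pverts G" unfolding k_def using False pair_finite_verts by simp
    then obtain w where w: "w \<in> pverts G" "c w = k" by blast
    have "c v \<le> k" if "v \<in> pverts G" for v using that pair_finite_verts by (simp add: k_def)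
    then have "c ` pverts G \<subseteq> {1..k}"
      using c by (auto simp: P_def)
    moreover have "i \<in> c ` pverts G" if "i \<in> {1..k}" for i
    proof (cases "i = k")
      case True
      then show ?thesis using w by blast
    next
      case False
      then show ?thesis using nb[OF w(1), of i] w(2) that by auto
    qed
    ultimately have "c ` pverts G = {1..k}" by blast
    then show ?thesis by blast
  qed
  then obtain k where "c ` pverts G = {1..k}" by blast
  then have "grundy_coloring G k c"
    using c nb by (auto simp: grundy_coloring_def P_def)
  then show ?thesis by blast
qed

end

theory Submission
  imports Defs
begin

text \<open>
  First-Fit extends every partial Grundy coloring, so it suffices to find one that uses the color
  \<open>\<delta>(G) + 1\<close>. The color class 1 will be an independent set \<open>J\<close> dominating a small set \<open>T\<close> whose
  induced subgraph has Grundy number \<open>\<delta>(G)\<close>. If \<open>T\<close> is a clique, every minimal set \<open>J\<close> outside \<open>T\<close>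
  dominating \<open>T\<close> is independent: adjacent \<open>u, w \<in> J\<close> with private neighbors \<open>t, s \<in> T\<close> would
  induce the 4-cycle \<open>t s w u\<close>. Cliques of size \<open>\<delta>(G)\<close> exist for \<open>\<delta>(G) \<le> 2\<close>; for \<open>\<delta>(G) = 3\<close> and a
  triangle-free \<open>G\<close> (then without any 4-cycle) take a path on four vertices for \<open>T\<close>, chosen inside
  a 5-cycle if there is one.
\<close>

section \<open>Adjacency, degrees and partial Grundy colorings\<close>

context pair_graph
begin

abbreviation adj :: "'a \<Rightarrow> 'a \<Rightarrow> bool" where
  "adj u v \<equiv> (u, v) \<in> parcs G"

text \<open>Color 0 means that the vertex is uncolored.\<close>

definition partial_grundy :: "('a \<Rightarrow> nat) \<Rightarrow> bool" where
  "partial_grundy c \<longleftrightarrow>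
     (\<forall>v. c v > 0 \<longrightarrow> v \<in> pverts G) \<and>
     (\<forall>u v. adj u v \<longrightarrow> c u > 0 \<longrightarrow> c u \<noteq> c v) \<and>
     (\<forall>v i. 0 < i \<longrightarrow> i < c v \<longrightarrow> (\<exists>u. adj v u \<and> c u = i))"

lemma adj_sym: "adj u v \<Longrightarrow> adj v u"
  using pair_sym_arcs by (auto simp: symmetric_def sym_def)

lemma adj_irrefl: "\<not> adj v v"
  using pair_no_loops by fastforce

lemma adj_verts: "adj u v \<Longrightarrow> u \<in> pverts G" "adj u v \<Longrightarrow> v \<in> pverts G"
  using wellformed' by auto

lemma finite_neighbors: "finite {u. adj v u}"
  by (rule finite_subset[OF _ pair_finite_verts]) (auto dest: adj_verts)

lemma out_degree_eq_card_neighbors: "out_degree G v = card {u. adj v u}"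
proof -
  have "out_arcs G v = Pair v ` {u. adj v u}"
    by (auto simp: out_arcs_def)
  then show ?thesis
    by (simp add: out_degree_def card_image inj_on_def)
qed

lemma min_degree_le_card_neighbors:
  assumes "v \<in> pverts G"
  shows "min_degree G \<le> card {u. adj v u}"
proof -
  have "min_degree G \<le> out_degree G v"
    unfolding min_degree_def using assms pair_finite_verts by (intro Min_le) auto
  then show ?thesis by (simp add: out_degree_eq_card_neighbors)
qed

lemma neighbor_outside:
  assumes "card S < card {u. adj v u}" "finite S"
  obtains u where "adj v u" "u \<notin> S"
  using card_mono[OF assms(2), of "{u. adj v u}"] assms(1) by fastforce

section \<open>Lower bounds on the Grundy number from partial colorings\<close>

text \<open>First-Fit by induction on the number of uncolored vertices: an uncolored vertex gets the
  least positive color absent from its neighborhood. Old colors stay, and with them the neighbors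
  that witness the Grundy condition.\<close>

lemma partial_grundy_extend:
  assumes "partial_grundy c"
  obtains d where "partial_grundy d" "\<And>v. v \<in> pverts G \<Longrightarrow> d v > 0"
    "\<And>v. c v > 0 \<Longrightarrow> d v = c v"
proof -
  have "\<exists>d. partial_grundy d \<and> (\<forall>v\<in>pverts G. d v > 0) \<and> (\<forall>v. c v > 0 \<longrightarrow> d v = c v)"
    using assms
  proof (induction "card {v \<in> pverts G. c v = 0}" arbitrary: c)
    case 0
    then have "{v \<in> pverts G. c v = 0} = {}"
      using pair_finite_verts by simp
    then show ?case using 0 by (intro exI[of _ c]) auto
  next
    case (Suc n)
    then obtain v where v: "v \<in> pverts G" "c v = 0"
      by (metis (mono_tags, lifting) card.empty empty_Collect_eq nat.distinct(1))
    define free where "free m \<longleftrightarrow> 0 < m \<and> (\<forall>u. adj v u \<longrightarrow> c u \<noteq> m)" for m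
    define m where "m = (LEAST m. free m)"
    define M where "M = Max (c ` {u. adj v u})"
    have "c u \<le> M" if "adj v u" for u
      unfolding M_def using finite_neighbors that by (intro Max_ge) auto
    \<comment> \<open>For an isolated \<open>v\<close>, \<open>M\<close> is an unspecified
      \<open>Max {}\<close>, but then every positive color is free.\<close>
    then have "free (Suc M)"
      by (fastforce simp: free_def)
    then have m: "free m" unfolding m_def by (rule LeastI)
    have below: "\<exists>u. adj v u \<and> c u = i" if "0 < i" "i < m" for i
      using not_less_Least[of i free] that by (auto simp: m_def free_def)
    let ?d = "c(v := m)"
    have "partial_grundy ?d"
      unfolding partial_grundy_def
    proof (intro conjI allI impI)
      fix x assume "?d x > 0"
      then show "x \<in> pverts G"
        using Suc.prems v by (auto simp: partial_grundy_def split: if_splits)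
    next
      fix x y assume xy: "adj x y" and pos: "?d x > 0"
      have "c x \<noteq> m" if "y = v" using m xy adj_sym that by (auto simp: free_def)
      moreover have "c y \<noteq> m" if "x = v" using m xy that by (auto simp: free_def)
      moreover have "x \<noteq> y" using xy adj_irrefl by auto
      moreover have "c x \<noteq> c y" if "c x > 0"
        using Suc.prems xy that unfolding partial_grundy_def by blast
      ultimately show "?d x \<noteq> ?d y"
        using pos by (auto split: if_splits)
    next
      fix x i assume i: "0 < i" "i < ?d x"
      have "\<exists>u. adj x u \<and> c u = i"
      proof (cases "x = v")
        case True
        then show ?thesis using below i by simp
      next
        case False
        then have "i < c x" using i by simp
        then show ?thesis using Suc.prems i(1) unfolding partial_grundy_def by blast
      qed
      then obtain u where "adj x u" "c u = i" by blast
      \<comment> \<open>The witness is not \<open>v\<close>, since \<open>c v = 0 < i\<close>; the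
        new color of \<open>v\<close> leaves it intact.\<close>
      then show "\<exists>u. adj x u \<and> ?d u = i"
        using v i by (intro exI[of _ u]) auto
    qed
    moreover have "n = card {x \<in> pverts G. ?d x = 0}"
    proof -
      have "{x \<in> pverts G. c x = 0} = insert v {x \<in> pverts G. ?d x = 0}"
        using v m by (auto simp: free_def)
      then show ?thesis
        using Suc.hyps(2) pair_finite_verts m by (simp add: free_def)
    qed
    ultimately obtain d where d: "partial_grundy d" "\<forall>v\<in>pverts G. d v > 0"
      "\<forall>x. ?d x > 0 \<longrightarrow> d x = ?d x"
      using Suc.hyps(1) by blast
    have "d x = c x" if "c x > 0" for x
      using d(3)[rule_format, of x] that v by (cases "x = v") auto
    then show ?case using d by blast
  qed
  then show thesis using that by blast
qed

text \<open>In a full extension, a vertex of the largest color \<open>k\<close> sees all smaller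
  colors, so exactly the colors 1 to \<open>k\<close> occur and \<open>k\<close> is at least
  \<open>c w\<close>.\<close>

lemma partial_grundy_le_grundy_number:
  assumes "partial_grundy c"
  shows "c w \<le> grundy_number G"
proof (cases "c w = 0")
  case False
  obtain d where d: "partial_grundy d" "\<And>v. v \<in> pverts G \<Longrightarrow> d v > 0"
    "\<And>v. c v > 0 \<Longrightarrow> d v = c v"
    using partial_grundy_extend[OF assms] by blast
  have w: "w \<in> pverts G" "d w = c w"
    using assms d(3) False by (auto simp: partial_grundy_def)
  define k where "k = Max (d ` pverts G)"
  have le: "d v \<le> k" if "v \<in> pverts G" for v
    using that pair_finite_verts by (simp add: k_def)
  have "k \<in> d ` pverts G"
    unfolding k_def using w pair_finite_verts by (intro Max_in) auto
  then obtain x where x: "x \<in> pverts G" "d x = k" by blast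
  have nbr: "\<exists>u\<in>pverts G. adj v u \<and> d u = i" if "0 < i" "i < d v" for v i
    using d(1) that adj_verts(2) unfolding partial_grundy_def by blast
  have "i \<in> d ` pverts G" if "0 < i" "i \<le> k" for i
  proof (cases "i = k")
    case True
    then show ?thesis using x by blast
  next
    case False
    then show ?thesis using nbr[of i x] that x by auto
  qed
  moreover have "d v \<in> {1..k}" if "v \<in> pverts G" for v
    using le[OF that] d(2)[OF that] by simp
  ultimately have "d ` pverts G = {1..k}" by fastforce
  moreover have "d u \<noteq> d v" if "adj u v" for u v
    using d(1) d(2)[OF adj_verts(1)[OF that]] that unfolding partial_grundy_def by blast
  ultimately have "grundy_coloring G k d"
    using nbr by (auto simp: grundy_coloring_def)
  then have "k \<le> grundy_number G"
    unfolding grundy_number_def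
    using finite_grundy_colorings[of "with_proj G"] pair_finite_verts by (intro Max_ge) auto
  then show ?thesis using le w by fastforce
qed simp

text \<open>The set \<open>J\<close> becomes the new color class 1 and all colors of
  \<open>c\<close> move up by one. Independence of \<open>J\<close> keeps the coloring proper, and
  domination supplies the neighbors of color 1.\<close>

lemma dominated_less_grundy_number:
  assumes c: "partial_grundy c" "c w > 0"
    and J: "\<And>u v. u \<in> J \<Longrightarrow> v \<in> J \<Longrightarrow> \<not> adj u v" "\<And>v. v \<in> J \<Longrightarrow> c v = 0"
    and dom: "\<And>v. c v > 0 \<Longrightarrow> \<exists>u\<in>J. adj v u"
  shows "c w < grundy_number G"
proof -
  \<comment> \<open>\<open>J\<close> may contain non-vertices, which have to stay uncolored.\<close>
  define d where "d v = (if v \<in> J \<and> v \<in> pverts G then 1 else if c v > 0 then Suc (c v) else 0)" for v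
  have "partial_grundy d"
    unfolding partial_grundy_def
  proof (intro conjI allI impI)
    fix v assume "d v > 0"
    then show "v \<in> pverts G"
      using c by (auto simp: d_def partial_grundy_def split: if_splits)
  next
    fix u v assume "adj u v" "d u > 0"
    then show "d u \<noteq> d v"
      using J c by (auto simp: d_def partial_grundy_def split: if_splits)
  next
    fix v i assume i: "0 < i" "i < d v"
    then have v: "c v > 0" "d v = Suc (c v)" by (auto simp: d_def split: if_splits)
    show "\<exists>u. adj v u \<and> d u = i"
    proof (cases "i = 1")
      case True
      then show ?thesis using dom[OF v(1)] adj_verts by (auto simp: d_def)
    next
      case False
      then have "0 < i - 1" "i - 1 < c v" using i v by auto
      then obtain u where "adj v u" "c u = i - 1"
        using c unfolding partial_grundy_def by blast
      then show ?thesis using i False J(2)[of u] by (intro exI[of _ u]) (auto simp: d_def)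
    qed
  qed
  then have "d w \<le> grundy_number G" by (rule partial_grundy_le_grundy_number)
  moreover have "d w = Suc (c w)" using c(2) J(2)[of w] by (auto simp: d_def)
  ultimately show ?thesis by simp
qed

text \<open>Any numbering of a clique by 1 to \<open>card T\<close> works, as each vertex is
  adjacent to the holders of all smaller numbers.\<close>

lemma clique_partial_grundy:
  assumes T: "T \<subseteq> pverts G" "\<And>u v. u \<in> T \<Longrightarrow> v \<in> T \<Longrightarrow> u \<noteq> v \<Longrightarrow> adj u v" and "T \<noteq> {}"
  obtains c w where "partial_grundy c" "c w = card T" "\<And>v. c v > 0 \<longleftrightarrow> v \<in> T"
proof -
  have fin: "finite T" using T(1) pair_finite_verts finite_subset by blast
  then obtain f where f: "bij_betw f T {1..card T}"
    using finite_same_card_bij[of T "{1..card T}"] by auto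
  define c where "c v = (if v \<in> T then f v else 0)" for v
  have pos: "c v > 0 \<longleftrightarrow> v \<in> T" for v
    using bij_betwE[OF f] by (auto simp: c_def)
  have surj: "\<exists>v\<in>T. c v = i" if "0 < i" "i \<le> card T" for i
  proof -
    have "i \<in> f ` T" using f that by (simp add: bij_betw_def)
    then show ?thesis by (auto simp: c_def)
  qed
  have "partial_grundy c"
    unfolding partial_grundy_def
  proof (intro conjI allI impI)
    fix v assume "c v > 0"
    then show "v \<in> pverts G" using pos T by blast
  next
    fix u v assume "adj u v" "c u > 0"
    then show "c u \<noteq> c v"
      using adj_irrefl pos bij_betw_imp_inj_on[OF f] by (metis c_def inj_onD less_numeral_extra(3))
  next
    fix v i assume i: "0 < i" "i < c v"
    then have "v \<in> T" using pos[of v] by simp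
    moreover from this have "c v \<le> card T" using bij_betwE[OF f] by (simp add: c_def)
    ultimately show "\<exists>u. adj v u \<and> c u = i"
      using surj[of i] i T(2) by (metis less_imp_le less_irrefl order_trans)
  qed
  moreover obtain w where "c w = card T"
    using surj[of "card T"] fin \<open>T \<noteq> {}\<close> by (auto simp: card_gt_0_iff)
  ultimately show thesis using that pos by blast
qed

end

section \<open>Four-cycles and their chords\<close>

locale c4_free_graph = pair_graph +
  assumes c4_free: "\<not> has_induced G (cycle_graph 4)"
begin

text \<open>Without a chord, the four vertices, which are distinct, would induce a copy of
  \<open>cycle_graph 4\<close>, with \<open>a\<close>, \<open>b\<close>, \<open>c\<close>,
  \<open>d\<close> numbered 0 to 3.\<close>

lemma four_cycle_chord:
  assumes ab: "adj a b" and bc: "adj b c" and cd: "adj c d" and da: "adj d a"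
    and ne: "a \<noteq> c" "b \<noteq> d"
  shows "adj a c \<or> adj b d"
proof (rule ccontr)
  assume no: "\<not> ?thesis"
  have sym: "adj b a" "adj c b" "adj d c" "adj a d" "\<not> adj c a" "\<not> adj d b"
    using assms no adj_sym by blast+
  have dist: "a \<noteq> b" "b \<noteq> c" "c \<noteq> d" "d \<noteq> a" using assms adj_irrefl by auto
  define S where "S = {a, b, c, d}"
  define R where "R = {(a, b), (b, c), (c, d), (d, a), (b, a), (c, b), (d, c), (a, d)}"
  have R: "{e \<in> parcs G. fst e \<in> S \<and> snd e \<in> S} = R"
  proof (intro equalityI subsetI)
    fix e assume "e \<in> {e \<in> parcs G. fst e \<in> S \<and> snd e \<in> S}"
    then obtain x y where xy: "e = (x, y)" "adj x y" "x \<in> S" "y \<in> S" by (cases e) simp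
    have "x = a \<or> x = b \<or> x = c \<or> x = d" "y = a \<or> y = b \<or> y = c \<or> y = d"
      using xy by (auto simp: S_def)
    then show "e \<in> R"
      using xy(2) no sym adj_irrefl unfolding xy(1) R_def by (elim disjE) simp_all
  next
    fix e assume "e \<in> R"
    then show "e \<in> {e \<in> parcs G. fst e \<in> S \<and> snd e \<in> S}"
      unfolding R_def S_def using ab bc cd da sym by (elim insertE emptyE) simp_all
  qed
  define g :: "'a \<Rightarrow> nat" where
    "g x = (if x = a then 0 else if x = b then 1 else if x = c then 2 else 3)" for x
  have g: "g a = 0" "g b = 1" "g c = 2" "g d = 3"
    using dist ne by (auto simp: g_def)
  define H :: "'a pair_pre_digraph" where "H = \<lparr>pverts = S, parcs = R\<rparr>"
  have wf: "wf_digraph H"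
    by unfold_locales (auto simp: H_def R_def S_def)
  have SV: "S \<subseteq> pverts G" using assms adj_verts by (auto simp: S_def)
  have RE: "R \<subseteq> parcs G" using R by blast
  have ind: "induced_subgraph H G"
    using wf SV RE R wf_digraph_axioms
    by (simp add: induced_subgraph_def subgraph_def compatible_def H_def)
  define f where "f = \<lparr>iso_verts = g, iso_arcs = map_prod g g, iso_head = snd, iso_tail = fst\<rparr>"
  have injg: "inj_on g S" using dist ne by (auto simp: S_def inj_on_def g)
  have "inj_on (map_prod g g) R"
    by (rule inj_on_subset[OF map_prod_inj_on[OF injg injg]]) (auto simp: R_def S_def)
  then have "pre_digraph.digraph_isomorphism H f"
    unfolding pre_digraph.digraph_isomorphism_def using wf injg by (auto simp: f_def H_def)
  moreover have "with_proj (cycle_graph 4) = app_iso f H"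
  proof -
    have "{..<4} = g ` S" by (auto simp: S_def g)
    moreover have "{(i, j). i < 4 \<and> j < 4 \<and> (j = Suc i mod 4 \<or> i = Suc j mod 4)} = map_prod g g ` R"
    proof -
      have "i < 4 \<and> j < 4 \<and> (j = Suc i mod 4 \<or> i = Suc j mod 4) \<longleftrightarrow>
          (i, j) \<in> {(0,1), (1,2), (2,3), (3,0), (1,0), (2,1), (3,2), (0,3)}" for i j :: nat
      proof (cases "i < 4 \<and> j < 4")
        case True
        then have "i = 0 \<or> i = 1 \<or> i = 2 \<or> i = 3" "j = 0 \<or> j = 1 \<or> j = 2 \<or> j = 3"
          by linarith+
        then show ?thesis by (elim disjE) simp_all
      next
        case False
        then show ?thesis by auto
      qed
      then have "{(i, j). i < 4 \<and> j < 4 \<and> (j = Suc i mod 4 \<or> i = Suc j mod 4)} =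
          {(0,1), (1,2), (2,3), (3,0), (1,0), (2,1), (3,2), (0,3 :: nat)}"
        by (intro set_eqI) (simp only: split_paired_all mem_Collect_eq prod.case)
      moreover have "map_prod g g ` R =
          {(0,1), (1,2), (2,3), (3,0), (1,0), (2,1), (3,2), (0,3)}"
        by (simp add: R_def g)
      ultimately show ?thesis by simp
    qed
    ultimately show ?thesis
      by (simp add: with_proj_def cycle_graph_def app_iso_def f_def H_def)
  qed
  ultimately show False
    using c4_free ind unfolding has_induced_def digraph_iso_def by blast
qed

section \<open>Cliques dominated by independent sets\<close>

lemma clique_independent_dominating:
  assumes T: "T \<subseteq> pverts G" "\<And>u v. u \<in> T \<Longrightarrow> v \<in> T \<Longrightarrow> u \<noteq> v \<Longrightarrow> adj u v"
    and deg: "\<And>v. v \<in> T \<Longrightarrow> card T \<le> card {u. adj v u}"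
  obtains J where "J \<inter> T = {}" "\<And>u v. u \<in> J \<Longrightarrow> v \<in> J \<Longrightarrow> \<not> adj u v"
    "\<And>v. v \<in> T \<Longrightarrow> \<exists>u\<in>J. adj v u"
proof -
  have fin: "finite T" using T(1) pair_finite_verts finite_subset by blast
  define P where "P J \<longleftrightarrow> J \<subseteq> pverts G - T \<and> (\<forall>v\<in>T. \<exists>u\<in>J. adj v u)" for J
  have "P (pverts G - T)"
    unfolding P_def
  proof (intro conjI ballI)
    fix v assume v: "v \<in> T"
    \<comment> \<open>At most \<open>card T - 1\<close> neighbors of \<open>v\<close> lie in the
      clique, so the degree bound forces one outside.\<close>
    have "card (T - {v}) < card {u. adj v u}"
      using deg[OF v] card_Diff1_less[OF fin v] by simp
    then obtain u where "adj v u" "u \<notin> T - {v}"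
      using neighbor_outside fin by (metis finite_Diff)
    then show "\<exists>u\<in>pverts G - T. adj v u" using adj_irrefl adj_verts by blast
  qed simp
  then obtain J where J: "P J" and least: "\<And>J'. P J' \<Longrightarrow> card J \<le> card J'"
    using ex_has_least_nat[of P _ card] by blast
  have finJ: "finite J" using J pair_finite_verts by (auto simp: P_def intro: finite_subset)
  \<comment> \<open>Removing \<open>u\<close> from the smallest dominating set \<open>J\<close>
    leaves some \<open>t\<close> in \<open>T\<close> undominated, so \<open>u\<close> is the only
    neighbor of \<open>t\<close> in \<open>J\<close>.\<close>
  have priv_nbr: "\<exists>t\<in>T. adj t u \<and> (\<forall>x\<in>J. adj t x \<longrightarrow> x = u)" if "u \<in> J" for u
  proof -
    have "\<not> P (J - {u})"
      using least[of "J - {u}"] card_Diff1_less[OF finJ that] by linarith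
    then obtain t where t: "t \<in> T" "\<not> (\<exists>x\<in>J - {u}. adj t x)"
      using J by (auto simp: P_def)
    moreover have "\<exists>x\<in>J. adj t x" using J t(1) by (simp add: P_def)
    ultimately show ?thesis by blast
  qed
  have "\<not> adj u w" if uw: "u \<in> J" "w \<in> J" for u w
  proof
    assume adj: "adj u w"
    obtain t where t: "t \<in> T" "adj t u" "\<forall>x\<in>J. adj t x \<longrightarrow> x = u" using priv_nbr[OF uw(1)] by blast
    obtain s where s: "s \<in> T" "adj s w" "\<forall>x\<in>J. adj s x \<longrightarrow> x = w" using priv_nbr[OF uw(2)] by blast
    have "u \<noteq> w" using adj adj_irrefl by auto
    have "\<not> adj t w" using t(3) uw(2) \<open>u \<noteq> w\<close> by blast
    have "\<not> adj s u" using s(3) uw(1) \<open>u \<noteq> w\<close> by blast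
    have "t \<noteq> s" using \<open>\<not> adj t w\<close> s(2) by blast
    then have "adj t s" by (rule T(2)[OF t(1) s(1)])
    moreover have "t \<noteq> w" "s \<noteq> u" using J uw t(1) s(1) by (auto simp: P_def)
    \<comment> \<open>Each possible chord of the 4-cycle \<open>t s w u\<close> gives
      \<open>t\<close> or \<open>s\<close> a second neighbor in \<open>J\<close>.\<close>
    ultimately have "adj t w \<or> adj s u"
      using four_cycle_chord[OF _ s(2) adj_sym[OF adj] adj_sym[OF t(2)]] by blast
    then show False using \<open>\<not> adj t w\<close> \<open>\<not> adj s u\<close> by blast
  qed
  moreover have "J \<inter> T = {}" "\<And>v. v \<in> T \<Longrightarrow> \<exists>u\<in>J. adj v u" using J by (auto simp: P_def)
  ultimately show thesis using that by blast
qed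

lemma clique_less_grundy_number:
  assumes T: "T \<subseteq> pverts G" "\<And>u v. u \<in> T \<Longrightarrow> v \<in> T \<Longrightarrow> u \<noteq> v \<Longrightarrow> adj u v" and "T \<noteq> {}"
    and deg: "\<And>v. v \<in> T \<Longrightarrow> card T \<le> card {u. adj v u}"
  shows "card T < grundy_number G"
proof -
  obtain c w where c: "partial_grundy c" "c w = card T" "\<And>v. c v > 0 \<longleftrightarrow> v \<in> T"
    using clique_partial_grundy[OF T \<open>T \<noteq> {}\<close>] by blast
  obtain J where J: "J \<inter> T = {}" "\<And>u v. u \<in> J \<Longrightarrow> v \<in> J \<Longrightarrow> \<not> adj u v"
    "\<And>v. v \<in> T \<Longrightarrow> \<exists>u\<in>J. adj v u"
    using clique_independent_dominating[OF T deg] by blast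
  have "c w > 0"
    using T(1) \<open>T \<noteq> {}\<close> pair_finite_verts c(2) by (auto simp: card_gt_0_iff finite_subset)
  moreover have "c v = 0" if "v \<in> J" for v using J(1) c(3)[of v] that by auto
  ultimately show ?thesis
    using dominated_less_grundy_number[OF c(1) _ J(2)] c J(3) by metis
qed

section \<open>Dominated paths in triangle-free graphs\<close>

lemma dominated_path_grundy_number:
  assumes path: "adj p q" "adj q r" "adj r s" "\<not> adj p s" "p \<noteq> r" "q \<noteq> s" "p \<noteq> s"
    and J: "\<And>u v. u \<in> J \<Longrightarrow> v \<in> J \<Longrightarrow> \<not> adj u v" "J \<inter> {p, q, r, s} = {}"
    and dom: "\<And>v. v \<in> {p, q, r, s} \<Longrightarrow> \<exists>u\<in>J. adj v u"
  shows "3 < grundy_number G"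
proof -
  \<comment> \<open>The path has colors 1, 3, 2, 1. The ends may share color 1 as they are not
    adjacent; \<open>q\<close> sees 1 at \<open>p\<close> and 2 at \<open>r\<close>, and
    \<open>r\<close> sees 1 at \<open>s\<close>. Below the new class \<open>J\<close>,
    \<open>q\<close> rises to color 4.\<close>
  define c :: "'a \<Rightarrow> nat" where
    "c v = (if v = p \<or> v = s then 1 else if v = r then 2 else if v = q then 3 else 0)" for v
  have dist: "p \<noteq> q" "q \<noteq> r" "r \<noteq> s" using path adj_irrefl by auto
  have c: "c p = 1" "c s = 1" "c r = 2" "c q = 3"
    using path dist by (auto simp: c_def)
  have cpos: "v \<in> {p, q, r, s}" if "c v > 0" for v
    using that by (auto simp: c_def split: if_splits)
  have "partial_grundy c"
    unfolding partial_grundy_def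
  proof (intro conjI allI impI)
    fix v assume "c v > 0"
    then show "v \<in> pverts G" using cpos path adj_verts by blast
  next
    fix u v assume uv: "adj u v" "c u > 0"
    have "\<not> adj s p" using path adj_sym by blast
    then show "c u \<noteq> c v"
      using uv path dist adj_irrefl by (auto simp: c_def split: if_splits)
  next
    fix v i assume i: "0 < i" "i < c v"
    consider "v = r" "i = 1" | "v = q" "i = 1" | "v = q" "i = 2"
      using i by (cases "i = 1") (auto simp: c_def split: if_splits)
    then show "\<exists>u. adj v u \<and> c u = i"
      using path adj_sym c by cases blast+
  qed
  moreover have "c v = 0" if "v \<in> J" for v using J(2) cpos[of v] that by auto
  ultimately show ?thesis
    using dominated_less_grundy_number[of c q J] J(1) cpos dom c by auto
qed

text \<open>Further neighbors of the path \<open>p q r s\<close> dominate it, and they are chosen so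
  that an edge between two of them would close a cycle that is excluded.\<close>

lemma triangle_free_less_grundy_number:
  assumes tri: "\<And>a b c. adj a b \<Longrightarrow> adj b c \<Longrightarrow> \<not> adj a c"
    and deg: "\<And>v. v \<in> pverts G \<Longrightarrow> 3 \<le> card {u. adj v u}"
    and "pverts G \<noteq> {}"
  shows "3 < grundy_number G"
proof -
  \<comment> \<open>A chord would create a triangle, so there is no 4-cycle: distinct
    \<open>a\<close> and \<open>c\<close> have at most one common neighbor.\<close>
  have quad: "b = d" if "adj a b" "adj b c" "adj c d" "adj d a" "a \<noteq> c" for a b c d
    using four_cycle_chord[of a b c d] that tri adj_sym by blast
  have nbr: "\<exists>u. adj v u \<and> u \<noteq> x \<and> u \<noteq> y" if "v \<in> pverts G" for v x y
  proof -
    have "card {x, y} < card {u. adj v u}"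
      using deg[OF that] by (intro le_less_trans[OF card_insert_le_m1[of 2]]) auto
    then obtain u where "adj v u" "u \<notin> {x, y}" using neighbor_outside by blast
    then show ?thesis by auto
  qed
  show ?thesis
  proof (cases "\<exists>p q r s w. adj p q \<and> adj q r \<and> adj r s \<and> adj s w \<and> adj w p")
    case True
    \<comment> \<open>A repeated vertex on this closed walk would leave a triangle, so it is a
      5-cycle. Its fifth vertex \<open>w\<close> dominates both ends of the path, and
      \<open>x\<close> and \<open>y\<close> dominate the middle.\<close>
    then obtain p q r s w where C: "adj p q" "adj q r" "adj r s" "adj s w" "adj w p" by blast
    obtain x where x: "adj q x" "x \<noteq> p" "x \<noteq> r" using nbr adj_verts C by metis
    obtain y where y: "adj r y" "y \<noteq> q" "y \<noteq> s" using nbr adj_verts C by metis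
    note sym = C[THEN adj_sym] x(1)[THEN adj_sym] y(1)[THEN adj_sym]
    show ?thesis
    proof (rule dominated_path_grundy_number)
      show "adj p q" "adj q r" "adj r s" by fact+
      show "\<not> adj p s" using tri C sym by blast
      show "p \<noteq> r" "q \<noteq> s" "p \<noteq> s" using tri C sym adj_irrefl by blast+
      \<comment> \<open>Each edge inside \<open>{w, x, y}\<close> would close a 4-cycle with an edge
        of the 5-cycle.\<close>
      have "\<not> adj x y" using quad[of x y r q] x y C sym by blast
      moreover have "\<not> adj w x" using quad[of w x q p] x y C sym tri by blast
      moreover have "\<not> adj w y" using quad[of w y r s] x y C sym tri by blast
      ultimately show "\<not> adj u v" if "u \<in> {w, x, y}" "v \<in> {w, x, y}" for u v
        using that adj_sym adj_irrefl by blast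
      show "{w, x, y} \<inter> {p, q, r, s} = {}"
        using C x y sym tri adj_irrefl by blast
      show "\<exists>u\<in>{w, x, y}. adj v u" if "v \<in> {p, q, r, s}" for v
        using that C x y sym by blast
    qed
  next
    case False
    then have pent: "\<not> adj w p" if "adj p q" "adj q r" "adj r s" "adj s w" for p q r s w
      using that by blast
    obtain q where q: "q \<in> pverts G" using assms(3) by blast
    obtain r where r: "adj q r" using nbr[OF q] by blast
    obtain p where p: "adj q p" "p \<noteq> r" using nbr[OF q] by blast
    obtain s where s: "adj r s" "s \<noteq> q" using nbr adj_verts r by metis
    obtain x where x: "adj q x" "x \<noteq> p" "x \<noteq> r" using nbr[OF q] by blast
    obtain y where y: "adj r y" "y \<noteq> q" "y \<noteq> s" using nbr adj_verts r by metis
    obtain z where z: "adj s z" "z \<noteq> r" using nbr adj_verts s by metis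
    \<comment> \<open>An edge from a neighbor of \<open>p\<close> to \<open>z\<close> would close a
      6-cycle, which is not excluded. Hence two candidates \<open>w1\<close> and \<open>w2\<close>:
      if both were adjacent to \<open>z\<close>, then \<open>p w1 z w2\<close> would be a
      4-cycle.\<close>
    obtain w1 where w1: "adj p w1" "w1 \<noteq> q" using nbr adj_verts p by metis
    obtain w2 where w2: "adj p w2" "w2 \<noteq> q" "w2 \<noteq> w1" using nbr adj_verts p by metis
    have "p \<noteq> z" using quad[of p q r s] p r s z adj_sym by blast
    then obtain w where w: "adj p w" "w \<noteq> q" "\<not> adj w z"
      using quad[of p w1 z w2] w1 w2 adj_sym by blast
    note sym = p(1)[THEN adj_sym] r[THEN adj_sym] s(1)[THEN adj_sym] x(1)[THEN adj_sym]
      y(1)[THEN adj_sym] z(1)[THEN adj_sym] w(1)[THEN adj_sym]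
    note adjs = sym p(1) r s(1) x(1) y(1) z(1) w(1)
    show ?thesis
    proof (rule dominated_path_grundy_number)
      show "adj p q" "adj q r" "adj r s" by fact+
      show ps: "\<not> adj p s" using quad[of p q r s] p s adjs adj_sym by blast
      show "p \<noteq> r" "q \<noteq> s" using p s by auto
      show "p \<noteq> s" using tri adjs by blast
      \<comment> \<open>Edges \<open>x y\<close>, \<open>w x\<close> and \<open>z y\<close> would
        close 4-cycles, edges \<open>w y\<close> and \<open>z x\<close> 5-cycles; \<open>w z\<close>
        is avoided by the choice of \<open>w\<close>.\<close>
      have "\<not> adj x y" using quad[of x y r q] x y adjs by blast
      moreover have "\<not> adj w x" using tri quad[of w x q p] x w adjs by blast
      moreover have "\<not> adj w y" using pent[of w p q r y] adjs adj_sym by blast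
      moreover have "\<not> adj z x" using pent[of z s r q x] adjs adj_sym by blast
      moreover have "\<not> adj z y" using quad[of z y r s] y z adjs by blast
      ultimately show "\<not> adj u v" if "u \<in> {w, x, y, z}" "v \<in> {w, x, y, z}" for u v
        using that adj_sym adj_irrefl w(3) by blast
      have "q \<noteq> z" using tri adjs by blast
      then show "{w, x, y, z} \<inter> {p, q, r, s} = {}"
        using p s w x y z ps adjs tri adj_irrefl \<open>p \<noteq> z\<close> by blast
      show "\<exists>u\<in>{w, x, y, z}. adj v u" if "v \<in> {p, q, r, s}" for v
        using that adjs by blast
    qed
  qed
qed

end

section \<open>Case distinction on the minimum degree\<close>

theorem theorem10:
  fixes G :: "'a pair_pre_digraph"
  assumes "pair_graph G"
    and "pverts G \<noteq> {}"
    and "\<not> has_induced G (cycle_graph 4)"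
    and "min_degree G \<le> 3"
  shows "grundy_number G \<ge> min_degree G + 1"
proof -
  interpret pair_graph G by fact
  interpret c4_free_graph G by unfold_locales fact
  have deg: "min_degree G \<le> card {u. adj v u}" if "v \<in> pverts G" for v
    by (rule min_degree_le_card_neighbors) fact
  have clique: ?thesis
    if "T \<subseteq> pverts G" "\<And>u v. u \<in> T \<Longrightarrow> v \<in> T \<Longrightarrow> u \<noteq> v \<Longrightarrow> adj u v" "T \<noteq> {}"
      "card T = min_degree G" for T
    using clique_less_grundy_number[OF that(1-3)] deg that(1,4) by fastforce
  \<comment> \<open>With no vertices, \<open>min_degree G\<close> would be the unspecified minimum
    of an empty set.\<close>
  obtain v where v: "v \<in> pverts G" using assms(2) by blast
  consider "min_degree G = 0" | "min_degree G = 1" | "min_degree G = 2" | "min_degree G = 3"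
    using assms(4) by linarith
  then show ?thesis
  proof cases
    \<comment> \<open>A clique of size 0 has no colored vertex; here one vertex of color 1 gives the
      bound.\<close>
    case 1
    then show ?thesis
      using clique_partial_grundy[of "{v}"] v partial_grundy_le_grundy_number
      by (metis One_nat_def add_0 card.empty card.insert empty_iff empty_subsetI finite.emptyI
          insert_not_empty insert_subset singletonD)
  next
    case 2
    then show ?thesis using clique[of "{v}"] v by simp
  next
    case 3
    then obtain u where u: "adj v u"
      using neighbor_outside[of "{}" v] deg[OF v] by auto
    then show ?thesis
      using clique[of "{v, u}"] 3 v adj_verts(2)[OF u] adj_sym[OF u] adj_irrefl[of v]
      by (cases "u = v") auto
  next
    case 4
    show ?thesis
    proof (cases "\<exists>a b c. adj a b \<and> adj b c \<and> adj a c")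
      case True
      then obtain a b c where abc: "adj a b" "adj b c" "adj a c" by blast
      then have "a \<noteq> b" "b \<noteq> c" "a \<noteq> c" using adj_irrefl by auto
      then have "card {a, b, c} = min_degree G" using 4 by simp
      moreover have "adj u v" if "u \<in> {a, b, c}" "v \<in> {a, b, c}" "u \<noteq> v" for u v
        using that abc adj_sym by blast
      moreover have "{a, b, c} \<subseteq> pverts G" using abc adj_verts by blast
      ultimately show ?thesis by (intro clique[of "{a, b, c}"]) auto
    next
      case False
      then show ?thesis
        using triangle_free_less_grundy_number 4 deg assms(2) by fastforce
    qed
  qed
qed

end
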